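(* Let $n,d\ge 1$ be integers and let $\mathscr{X}\subset\mathbb{R}^n$ be a compact semi-algebraic set with non-empty interior. Consider the problem $$\inf_{y}\; -\log\det M_d(y)\quad\text{subject to}\quad y\in\mathscr{M}_{2d}(\mathscr{X}),\;\; a^{\top}y=1,$$ where $a\in\mathbb{R}^{n_{2d}}$ is the coefficient vector of the constant polynomial $1$ in the basis $v_{2d}$, so that $a^{\top}y=\int_{\mathscr{X}}d\mu$ whenever $y=\int_{\mathscr{X}}v_{2d}\,d\mu$ (i.e. the minimization is over moment vectors of probability measures on $\mathscr{X}$), and where the domain of $\log\det$ is the cone of positive definite matrices. Then this problem has a unique solution $\hat y$, and $$\hat y\in\mathscr{M}_{2d}\big(\{x\in\mathscr{X}: p(x)=n_d\}\big),$$ where $p(x):=v_d(x)^{\top}M_d(\hat y)^{-1}v_d(x)$ is the Christoffel-Darboux polynomial associated to $\hat y$.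
   Context: For an integer $k\ge 0$, $n_k:=\frac{(n+k)!}{n!\,k!}$ is the dimension of the space of real polynomials of degree at most $k$ in $x\in\mathbb{R}^n$, and $v_k(x)\in\mathbb{R}^{n_k}$ is a (fixed) vector of polynomials whose entries form a basis of that space. $\mathbb{S}^{k}$ is the space of real symmetric $k\times k$ matrices. Moment cone: for a set $K\subset\mathbb{R}^n$, $\mathscr{M}_{k}(K):=\{y\in\mathbb{R}^{n_k}: y=\int_{K}v_k(x)\,d\mu(x)\text{ for some positive Borel measure }\mu\text{ on }K\}$. Moment matrix: each entry of $v_d(x)v_d(x)^{\top}$ is a polynomial of degree at most $2d$, so there are unique matrices $B_\alpha\in\mathbb{S}^{n_d}$ with $v_d(x)v_d(x)^{\top}=\sum_{\alpha=1}^{n_{2d}}B_\alpha\,(v_{2d}(x))_\alpha$. Define the linear map $M_d:\mathbb{R}^{n_{2d}}\to\mathbb{S}^{n_d}$ by $M_d(y):=\sum_\alpha B_\alpha y_\alpha$; thus if $y=\int_{\mathscr{X}}v_{2d}\,d\mu$, then $M_d(y)=\int_{\mathscr{X}}v_d(x)v_d(x)^{\top}d\mu(x)$. Convention: since the domain of $\log\det$ is the cone of positive definite matrices, $-\log\det M_d(y)$ is taken to be $+\infty$ when $M_d(y)$ is not positive definite. *)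

theory Defs
  imports "HOL-Analysis.Analysis"
begin

subsection \<open>Polynomials of bounded total degree\<close>

definition poly_dim :: "nat \<Rightarrow> nat \<Rightarrow> nat" where
  "poly_dim n k = (n + k) choose k"

lemma poly_dim_fact: "real (poly_dim n k) = fact (n + k) / (fact n * fact k)"
  by (simp add: poly_dim_def binomial_fact mult.commute)

definition monomial_fun :: "('n::finite \<Rightarrow> nat) \<Rightarrow> real ^ 'n \<Rightarrow> real" where
  "monomial_fun e x = (\<Prod>i\<in>UNIV. (x $ i) ^ e i)"

definition exponents :: "nat \<Rightarrow> ('n::finite \<Rightarrow> nat) set" where
  "exponents k = {e. (\<Sum>i\<in>UNIV. e i) \<le> k}"

definition polys :: "nat \<Rightarrow> (real ^ 'n::finite \<Rightarrow> real) set" where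
  "polys k = {f. \<exists>c. \<forall>x. f x = (\<Sum>e\<in>exponents k. c e * monomial_fun e x)}"

text \<open>The entries of \<open>v\<close> form a basis of \<^term>\<open>polys k\<close>: they belong to the space, are linearly
  independent (as an indexed family), and span it.\<close>

definition poly_basis :: "nat \<Rightarrow> (real ^ 'n::finite \<Rightarrow> real ^ 'm::finite) \<Rightarrow> bool" where
  "poly_basis k v \<longleftrightarrow>
     (\<forall>i. (\<lambda>x. v x $ i) \<in> polys k) \<and>
     (\<forall>c. (\<forall>x. c \<bullet> v x = 0) \<longrightarrow> c = 0) \<and>
     (\<forall>f\<in>polys k. \<exists>c. \<forall>x. f x = c \<bullet> v x)"

subsection \<open>Semi-algebraic sets\<close>

inductive semialgebraic :: "(real ^ 'n::finite) set \<Rightarrow> bool" where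
  pos: "real_polynomial_function f \<Longrightarrow> semialgebraic {x. f x > 0}"
| zero: "real_polynomial_function f \<Longrightarrow> semialgebraic {x. f x = 0}"
| Un: "semialgebraic S \<Longrightarrow> semialgebraic T \<Longrightarrow> semialgebraic (S \<union> T)"
| Int: "semialgebraic S \<Longrightarrow> semialgebraic T \<Longrightarrow> semialgebraic (S \<inter> T)"
| Compl: "semialgebraic S \<Longrightarrow> semialgebraic (- S)"

subsection \<open>Moment cone and moment matrix\<close>

text \<open>Integrability is required explicitly because the Bochner integral of a non-integrable
  function is \<open>0\<close> by convention.\<close>

definition moment_cone :: "(real ^ 'n::finite \<Rightarrow> real ^ 'm::finite) \<Rightarrow> (real ^ 'n) set \<Rightarrow> (real ^ 'm) set" where
  "moment_cone v K = {y. \<exists>\<mu>. sets \<mu> = sets (restrict_space borel K) \<and>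
     integrable \<mu> v \<and> y = (\<integral>x. v x \<partial>\<mu>)}"

definition outer :: "real ^ 'm::finite \<Rightarrow> real ^ 'm ^ 'm" where
  "outer u = (\<chi> i j. u $ i * u $ j)"

definition moment_basis ::
  "(real ^ 'n::finite \<Rightarrow> real ^ 'm::finite) \<Rightarrow> (real ^ 'n \<Rightarrow> real ^ 'q::finite) \<Rightarrow> 'q \<Rightarrow> real ^ 'm ^ 'm" where
  "moment_basis v w = (THE B. \<forall>x. outer (v x) = (\<Sum>\<alpha>\<in>UNIV. (w x $ \<alpha>) *\<^sub>R B \<alpha>))"

definition moment_matrix ::
  "(real ^ 'n::finite \<Rightarrow> real ^ 'm::finite) \<Rightarrow> (real ^ 'n \<Rightarrow> real ^ 'q::finite) \<Rightarrow> real ^ 'q \<Rightarrow> real ^ 'm ^ 'm" where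
  "moment_matrix v w y = (\<Sum>\<alpha>\<in>UNIV. (y $ \<alpha>) *\<^sub>R moment_basis v w \<alpha>)"

subsection \<open>The design problem\<close>

definition pos_definite :: "real ^ 'm::finite ^ 'm \<Rightarrow> bool" where
  "pos_definite A \<longleftrightarrow> transpose A = A \<and> (\<forall>u. u \<noteq> 0 \<longrightarrow> u \<bullet> (A *v u) > 0)"

definition neg_log_det :: "real ^ 'm::finite ^ 'm \<Rightarrow> ereal" where
  "neg_log_det A = (if pos_definite A then ereal (- ln (det A)) else \<infinity>)"

definition christoffel_darboux ::
  "(real ^ 'n::finite \<Rightarrow> real ^ 'm::finite) \<Rightarrow> (real ^ 'n \<Rightarrow> real ^ 'q::finite) \<Rightarrow> real ^ 'q \<Rightarrow> real ^ 'n \<Rightarrow> real" where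
  "christoffel_darboux v w y x = v x \<bullet> (matrix_inv (moment_matrix v w y) *v v x)"

text \<open>\<open>is_arg_min f P y\<close> says that \<open>y\<close> minimizes \<open>f\<close> among the points satisfying \<open>P\<close>;
  here \<open>a\<close> is the coefficient vector of the constant polynomial \<open>1\<close> in the basis \<open>w\<close>.\<close>

definition optimal_moments ::
  "(real ^ 'n::finite \<Rightarrow> real ^ 'm::finite) \<Rightarrow> (real ^ 'n \<Rightarrow> real ^ 'q::finite) \<Rightarrow> real ^ 'q \<Rightarrow>
    (real ^ 'n) set \<Rightarrow> real ^ 'q \<Rightarrow> bool" where
  "optimal_moments v w a X =
     is_arg_min (\<lambda>y. neg_log_det (moment_matrix v w y)) (\<lambda>y. y \<in> moment_cone w X \<and> a \<bullet> y = 1)"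

subsection \<open>The matrices defining the moment matrix exist and are unique\<close>

lemma finite_exponents: "finite (exponents k :: ('n::finite \<Rightarrow> nat) set)"
proof (rule finite_subset)
  show "exponents k \<subseteq> (UNIV::'n set) \<rightarrow>\<^sub>E {..k}"
  proof
    fix e :: "'n \<Rightarrow> nat" assume "e \<in> exponents k"
    then have s: "sum e UNIV \<le> k" by (simp add: exponents_def)
    have "e i \<le> k" for i
      using member_le_sum[of i UNIV e] s by simp
    then show "e \<in> UNIV \<rightarrow>\<^sub>E {..k}" by (auto simp: PiE_def)
  qed
  show "finite ((UNIV::'n set) \<rightarrow>\<^sub>E {..k})" by (rule finite_PiE) auto
qed

lemma polys_add: "f \<in> polys k \<Longrightarrow> g \<in> polys k \<Longrightarrow> (\<lambda>x. f x + g x) \<in> polys k"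
proof -
  assume "f \<in> polys k" "g \<in> polys k"
  then obtain c d where "\<forall>x. f x = (\<Sum>e\<in>exponents k. c e * monomial_fun e x)"
    "\<forall>x. g x = (\<Sum>e\<in>exponents k. d e * monomial_fun e x)"
    by (auto simp: polys_def)
  then show ?thesis
    by (auto simp: polys_def sum.distrib distrib_right intro!: exI[of _ "\<lambda>e. c e + d e"])
qed

lemma polys_cmult: "f \<in> polys k \<Longrightarrow> (\<lambda>x. a * f x) \<in> polys k"
proof -
  assume "f \<in> polys k"
  then obtain c where "\<forall>x. f x = (\<Sum>e\<in>exponents k. c e * monomial_fun e x)"
    by (auto simp: polys_def)
  then show ?thesis
    by (auto simp: polys_def sum_distrib_left mult.assoc intro!: exI[of _ "\<lambda>e. a * c e"])
qed

lemma polys_sum: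
  assumes "\<And>i. i \<in> I \<Longrightarrow> f i \<in> polys k"
  shows "(\<lambda>x. \<Sum>i\<in>I. f i x) \<in> polys k"
proof -
  have zero: "(\<lambda>x. 0) \<in> polys k" by (auto simp: polys_def intro!: exI[of _ "\<lambda>_. 0"])
  show ?thesis
    using assms by (induction I rule: infinite_finite_induct) (auto simp: zero polys_add)
qed

lemma monomial_in_polys:
  assumes "e \<in> exponents k" shows "monomial_fun e \<in> polys k"
proof -
  have "(\<Sum>e'\<in>exponents k. (if e' = e then 1 else 0) * monomial_fun e' x) = monomial_fun e x" for x
    using assms by (simp add: if_distrib[of "\<lambda>t. t * _"] finite_exponents cong: if_cong)
  then show ?thesis
    by (auto simp: polys_def intro!: exI[of _ "\<lambda>e'. if e' = e then 1 else 0"])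
qed

lemma polys_mult:
  assumes "f \<in> polys j" "g \<in> polys k"
  shows "(\<lambda>x. f x * g x) \<in> polys (j + k)"
proof -
  obtain c d where f: "\<And>x. f x = (\<Sum>e\<in>exponents j. c e * monomial_fun e x)"
    and g: "\<And>x. g x = (\<Sum>e\<in>exponents k. d e * monomial_fun e x)"
    using assms by (auto simp: polys_def)
  have m: "monomial_fun e x * monomial_fun e' x = monomial_fun (\<lambda>i. e i + e' i) x"
    for e e' :: "'a \<Rightarrow> nat" and x
    by (simp add: monomial_fun_def power_add prod.distrib)
  have "f x * g x = (\<Sum>e\<in>exponents j. \<Sum>e'\<in>exponents k.
      (c e * d e') * monomial_fun (\<lambda>i. e i + e' i) x)" for x
    unfolding f g sum_product m[symmetric] by (simp only: mult_ac)
  moreover have "(\<lambda>x. \<Sum>e\<in>exponents j. \<Sum>e'\<in>exponents k.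
      (c e * d e') * monomial_fun (\<lambda>i. e i + e' i) x) \<in> polys (j + k)"
    by (intro polys_sum polys_cmult monomial_in_polys) (auto simp: exponents_def sum.distrib)
  ultimately show ?thesis by (simp only:)
qed

lemma polys_mono: "j \<le> k \<Longrightarrow> polys j \<subseteq> polys k"
proof
  fix f :: "real ^ 'n \<Rightarrow> real" assume "j \<le> k" "f \<in> polys j"
  then obtain c where f: "\<And>x. f x = (\<Sum>e\<in>exponents j. c e * monomial_fun e x)"
    by (auto simp: polys_def)
  have "(\<lambda>x. \<Sum>e\<in>exponents j. c e * monomial_fun e x) \<in> polys k"
    using \<open>j \<le> k\<close> by (intro polys_sum polys_cmult monomial_in_polys) (auto simp: exponents_def)
  moreover have "f = (\<lambda>x. \<Sum>e\<in>exponents j. c e * monomial_fun e x)" by (rule ext) (rule f)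
  ultimately show "f \<in> polys k" by (simp only:)
qed

lemma real_polynomial_function_iff_polys:
  "real_polynomial_function f \<longleftrightarrow> (\<exists>k. f \<in> polys k)" for f :: "real ^ 'n::finite \<Rightarrow> real"
proof
  assume "real_polynomial_function f"
  then show "\<exists>k. f \<in> polys k"
  proof induction
    case (linear f)
    have proj: "(\<lambda>x. x $ i) \<in> polys 1" for i :: 'n
    proof -
      have "monomial_fun (\<lambda>j. if j = i then 1 else 0) x = x $ i" for x :: "real ^ 'n"
        by (simp add: monomial_fun_def if_distrib[of "\<lambda>t. _ ^ t"] cong: if_cong)
      then have *: "monomial_fun (\<lambda>j. if j = i then 1 else 0) = (\<lambda>x::real ^ 'n. x $ i)"
        unfolding fun_eq_iff by blast
      have "monomial_fun (\<lambda>j. if j = i then 1 else 0) \<in> (polys 1 :: (real ^ 'n \<Rightarrow> real) set)"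
        by (intro monomial_in_polys) (simp add: exponents_def)
      then show ?thesis by (simp only: *)
    qed
    have "f = (\<lambda>x. \<Sum>i\<in>UNIV. f (axis i 1) * x $ i)"
    proof (rule ext)
      fix x
      have "f x = f (\<Sum>i\<in>UNIV. (x $ i) *\<^sub>R axis i 1)"
        using basis_expansion[of x] by (simp only: scalar_mult_eq_scaleR)
      also have "\<dots> = (\<Sum>i\<in>UNIV. f (axis i 1) * x $ i)"
        using bounded_linear.linear[OF linear] by (simp add: linear_sum linear_scale mult.commute)
      finally show "f x = (\<Sum>i\<in>UNIV. f (axis i 1) * x $ i)" .
    qed
    moreover have "(\<lambda>x. \<Sum>i\<in>UNIV. f (axis i 1) * x $ i) \<in> polys 1"
      by (intro polys_sum polys_cmult proj)
    ultimately show ?case by metis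
  next
    case (const c)
    have z: "(exponents 0 :: ('n \<Rightarrow> nat) set) = {\<lambda>_. 0}" by (auto simp: exponents_def)
    have "(\<lambda>x. c) \<in> (polys 0 :: (real ^ 'n \<Rightarrow> real) set)"
      by (auto simp: polys_def z monomial_fun_def)
    then show ?case by blast
  next
    case (add f g)
    then obtain j k where "f \<in> polys j" "g \<in> polys k" by blast
    then have "f \<in> polys (max j k)" "g \<in> polys (max j k)"
      using polys_mono[of j "max j k"] polys_mono[of k "max j k"] by auto
    then show ?case using polys_add by blast
  next
    case (mult f g)
    then show ?case using polys_mult by blast
  qed
next
  assume "\<exists>k. f \<in> polys k"
  then obtain k c where f: "\<And>x. f x = (\<Sum>e\<in>exponents k. c e * monomial_fun e x)"
    by (auto simp: polys_def)
  have "real_polynomial_function (\<lambda>x. (x $ i) ^ m)" for i :: 'n and m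
    by (intro real_polynomial_function_power real_polynomial_function.intros(1) bounded_linear_vec_nth)
  then have "real_polynomial_function (\<lambda>x. \<Sum>e\<in>exponents k. c e * monomial_fun e x)"
    unfolding monomial_fun_def
    by (intro real_polynomial_function_sum real_polynomial_function.intros(4)
        real_polynomial_function.intros(2) real_polynomial_function_prod finite_exponents finite)
  moreover have "f = (\<lambda>x. \<Sum>e\<in>exponents k. c e * monomial_fun e x)" by (rule ext) (rule f)
  ultimately show "real_polynomial_function f" by (simp only:)
qed

lemma ex1_moment_basis:
  assumes v: "poly_basis d v" and w: "poly_basis (2 * d) w"
  shows "\<exists>!B. \<forall>x. outer (v x) = (\<Sum>\<alpha>\<in>UNIV. (w x $ \<alpha>) *\<^sub>R B \<alpha>)"
proof -
  have entry: "(\<Sum>\<alpha>\<in>UNIV. (w x $ \<alpha>) *\<^sub>R B \<alpha>) $ i $ j = (\<chi> \<alpha>. B \<alpha> $ i $ j) \<bullet> w x" for B x i j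
    by (simp add: inner_vec_def mult.commute)
  show ?thesis
  proof (rule ex_ex1I)
    have "(\<lambda>x. v x $ i * v x $ j) \<in> polys (2 * d)" for i j
      using polys_mult[of "\<lambda>x. v x $ i" d "\<lambda>x. v x $ j" d] v by (simp add: poly_basis_def mult_2)
    then have "\<exists>c. \<forall>x. v x $ i * v x $ j = c \<bullet> w x" for i j
      using w by (simp add: poly_basis_def)
    then obtain C where C: "\<And>i j x. v x $ i * v x $ j = C i j \<bullet> w x" by metis
    have "outer (v x) = (\<Sum>\<alpha>\<in>UNIV. (w x $ \<alpha>) *\<^sub>R (\<chi> i j. C i j $ \<alpha>))" for x
      unfolding vec_eq_iff entry by (simp add: outer_def C)
    then show "\<exists>B. \<forall>x. outer (v x) = (\<Sum>\<alpha>\<in>UNIV. (w x $ \<alpha>) *\<^sub>R B \<alpha>)"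
      by (intro exI[of _ "\<lambda>\<alpha>. \<chi> i j. C i j $ \<alpha>"]) blast
  next
    fix B B' assume "\<forall>x. outer (v x) = (\<Sum>\<alpha>\<in>UNIV. (w x $ \<alpha>) *\<^sub>R B \<alpha>)"
      and "\<forall>x. outer (v x) = (\<Sum>\<alpha>\<in>UNIV. (w x $ \<alpha>) *\<^sub>R B' \<alpha>)"
    then have "(\<Sum>\<alpha>\<in>UNIV. (w x $ \<alpha>) *\<^sub>R B \<alpha>) = (\<Sum>\<alpha>\<in>UNIV. (w x $ \<alpha>) *\<^sub>R B' \<alpha>)" for x
      by (simp only:)
    then have "(\<chi> \<alpha>. B \<alpha> $ i $ j) \<bullet> w x = (\<chi> \<alpha>. B' \<alpha> $ i $ j) \<bullet> w x" for i j x
      unfolding entry[symmetric] by (rule arg_cong)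
    then have "((\<chi> \<alpha>. B \<alpha> $ i $ j) - (\<chi> \<alpha>. B' \<alpha> $ i $ j)) \<bullet> w x = 0" for i j x
      by (simp add: inner_diff_left)
    then have "(\<chi> \<alpha>. B \<alpha> $ i $ j) - (\<chi> \<alpha>. B' \<alpha> $ i $ j) = 0" for i j
      using w unfolding poly_basis_def by blast
    then show "B = B'" by (auto simp: fun_eq_iff vec_eq_iff)
  qed
qed

lemma moment_basis_eq:
  assumes "poly_basis d v" "poly_basis (2 * d) w"
  shows "outer (v x) = (\<Sum>\<alpha>\<in>UNIV. (w x $ \<alpha>) *\<^sub>R moment_basis v w \<alpha>)"
  unfolding moment_basis_def by (rule theI'[OF ex1_moment_basis[OF assms], THEN spec])

end

theory Submission
  imports Defs
begin

text \<open>
  A problem about measures becomes one about the compact convex set \<open>C = convex hull (w ` X)\<close>.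
  Separating a point from a closed convex set shows that the moments of a probability measure on
  \<open>X\<close> lie in \<open>C\<close>, and weights on finitely many points realize all of \<open>C\<close>
  (\<open>probability_moments_eq_convex_hull\<close>). So every vector of moments has an atomic
  representing measure, and the rest of the proof takes place in finite dimension.

  On \<open>C\<close> the moment matrix \<open>M y\<close> is positive semidefinite, so a nonzero determinant is a positive one
  and means that \<open>M y\<close> is positive definite. A relative interior point of \<open>C\<close> has a positive definite
  moment matrix, because a polynomial that vanishes on a set with interior points is zero. Hence the
  solutions are exactly the maximizers of the continuous function \<open>y \<mapsto> det (M y)\<close> on \<open>C\<close>, which
  exist by compactness (\<open>optimal_moments_iff_det_maximal\<close>, \<open>ex_det_maximal_moments\<close>).

  What the determinant does along a segment from a positive definite \<open>A\<close> to a symmetric \<open>B\<close> is read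
  off from a simultaneous diagonalization: after a congruence, \<open>A\<close> is the identity and \<open>B\<close> is diagonal
  with entries \<open>l i\<close>, so \<open>det ((1 - t) A + t B)\<close> is a positive constant times
  \<open>\<Prod>i. (1 - t) + t * l i\<close>. At \<open>t = 1/2\<close> this gives strict log-concavity of the determinant
  (\<open>det_midpoint_strict\<close>). Since \<open>M\<close> is injective, two solutions would have a midpoint with larger
  determinant, so the solution is unique. The derivative at \<open>t = 0\<close> is the
  first order condition \<open>trace (A\<^sup>-\<^sup>1 B) \<le> m\<close>, where \<open>m\<close> is the size of the matrices
  (\<open>trace_inverse_le_if_det_maximal\<close>).

  For the support, let \<open>y\<close> be the solution and let \<open>L z = trace ((M y)\<^sup>-\<^sup>1 (M z))\<close>. This linear functional
  takes the value \<open>p x\<close> of the Christoffel-Darboux polynomial at \<open>w x\<close>, is at most \<open>m\<close> on \<open>C\<close>, and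
  equals \<open>m\<close> at \<open>y\<close>. So \<open>y\<close> is a convex combination of points \<open>w x\<close> with \<open>p x = m\<close> only.
\<close>

section \<open>Simultaneous diagonalization of quadratic forms\<close>

lemma symmetric_matrix_inner:
  fixes N :: "real ^ 'm ^ 'm"
  assumes "transpose N = N"
  shows "x \<bullet> (N *v y) = y \<bullet> (N *v x)"
  using assms dot_lmul_matrix[of x N y] vector_transpose_matrix[of x N] transpose_matrix_vector[of N x]
  by (simp add: inner_commute)

text \<open>A nonnegative quadratic form attains its minimum at every isotropic vector \<open>x\<close>, so its
  directional derivatives vanish there. The step \<open>t\<close> below makes the linear term dominate.\<close>
lemma semidefinite_null_vector:
  fixes N :: "real ^ 'm ^ 'm"
  assumes sym: "transpose N = N" and V: "subspace V"
    and psd: "\<And>h. h \<in> V \<Longrightarrow> 0 \<le> h \<bullet> (N *v h)"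
    and x: "x \<in> V" "x \<bullet> (N *v x) = 0" and h: "h \<in> V"
  shows "h \<bullet> (N *v x) = 0"
proof (rule ccontr)
  define p where "p = h \<bullet> (N *v x)"
  define q where "q = h \<bullet> (N *v h)"
  assume "h \<bullet> (N *v x) \<noteq> 0"
  then have p: "p \<noteq> 0" by (simp add: p_def)
  have q: "0 \<le> q" using psd[OF h] by (simp add: q_def)
  define t where "t = - p / (q + 1)"
  have pt: "p = - (t * (q + 1))" using q by (simp add: t_def)
  have "x + t *\<^sub>R h \<in> V" using V x h by (intro subspace_add subspace_scale)
  then have "0 \<le> (x + t *\<^sub>R h) \<bullet> (N *v (x + t *\<^sub>R h))" by (rule psd)
  also have "\<dots> = 2 * t * p + t\<^sup>2 * q"
    using symmetric_matrix_inner[OF sym, of x h] x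
    by (simp add: matrix_vector_right_distrib matrix_vector_mult_scaleR inner_add_left
        inner_add_right p_def q_def power2_eq_square algebra_simps)
  also have "\<dots> = - (t\<^sup>2 * (q + 2))"
    unfolding pt by (simp add: power2_eq_square algebra_simps)
  also have "\<dots> < 0"
    using p q by (simp add: t_def)
  finally show False by simp
qed

text \<open>The Rayleigh quotient of \<open>B\<close> relative to \<open>A\<close> has a maximum \<open>l\<close> on the unit sphere of \<open>V\<close>. Then
  \<open>l A - B\<close> is nonnegative on \<open>V\<close> and vanishes at the maximizer, which makes the maximizer an
  eigenvector of \<open>B\<close> relative to \<open>A\<close>, as far as vectors of \<open>V\<close> can test it.\<close>
lemma exists_relative_eigenvector:
  fixes A B :: "real ^ 'm ^ 'm"
  assumes A: "pos_definite A" and B: "transpose B = B" and V: "subspace V" "V \<noteq> {0}"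
  obtains x l where "x \<in> V" "x \<bullet> (A *v x) = 1"
    "\<And>h. h \<in> V \<Longrightarrow> h \<bullet> (B *v x) = l * (h \<bullet> (A *v x))"
proof -
  have Apos: "u \<noteq> 0 \<Longrightarrow> 0 < u \<bullet> (A *v u)" and As: "transpose A = A" for u
    using A by (auto simp: pos_definite_def)
  let ?K = "V \<inter> sphere 0 1"
  let ?r = "\<lambda>x. (x \<bullet> (B *v x)) / (x \<bullet> (A *v x))"
  have "compact ?K"
    using V(1) by (intro closed_Int_compact closed_subspace) auto
  moreover have "?K \<noteq> {}"
  proof -
    obtain u where "u \<in> V" "u \<noteq> 0" using V subspace_0 by blast
    then have "u /\<^sub>R norm u \<in> ?K" using V(1) by (auto intro: subspace_scale)
    then show ?thesis by blast
  qed
  moreover have "continuous_on ?K ?r"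
  proof (intro continuous_intros ballI)
    fix x assume "x \<in> ?K"
    then have "x \<noteq> 0" by auto
    then show "x \<bullet> (A *v x) \<noteq> 0" using Apos[of x] by simp
  qed
  ultimately obtain z where z: "z \<in> ?K" and zmax: "\<And>x. x \<in> ?K \<Longrightarrow> ?r x \<le> ?r z"
    using continuous_attains_sup[of ?K ?r] by blast
  define l where "l = ?r z"
  have z0: "z \<noteq> 0" "z \<in> V" using z by auto
  have "0 \<le> h \<bullet> ((l *\<^sub>R A - B) *v h)" if h: "h \<in> V" for h
  proof (cases "h = 0")
    case False
    have "h /\<^sub>R norm h \<in> ?K" using V(1) h False by (auto intro: subspace_scale)
    from zmax[OF this] have "?r h \<le> l"
      using False by (simp add: l_def matrix_vector_mult_scaleR)
    then show ?thesis
      using Apos[OF False]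
      by (simp add: divide_le_eq matrix_vector_mult_diff_rdistrib inner_diff_right
          scaleR_matrix_vector_assoc[symmetric])
  qed simp
  moreover have "transpose (l *\<^sub>R A - B) = l *\<^sub>R A - B"
    using As B by (simp add: transpose_def vec_eq_iff)
  moreover have "z \<bullet> ((l *\<^sub>R A - B) *v z) = 0"
    using Apos[OF z0(1)] by (simp add: l_def matrix_vector_mult_diff_rdistrib inner_diff_right
          scaleR_matrix_vector_assoc[symmetric])
  ultimately have null: "h \<bullet> ((l *\<^sub>R A - B) *v z) = 0" if "h \<in> V" for h
    using semidefinite_null_vector V(1) z0(2) that by blast
  define s where "s = sqrt (z \<bullet> (A *v z))"
  have s: "s > 0" "s * s = z \<bullet> (A *v z)" using Apos[OF z0(1)] by (simp_all add: s_def)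
  show ?thesis
  proof (rule that)
    show "z /\<^sub>R s \<in> V" using V(1) z0 by (auto intro: subspace_scale)
    show "(z /\<^sub>R s) \<bullet> (A *v (z /\<^sub>R s)) = 1"
      using s(1) by (simp add: matrix_vector_mult_scaleR s(2)[symmetric] inverse_eq_divide)
    show "h \<bullet> (B *v (z /\<^sub>R s)) = l * (h \<bullet> (A *v (z /\<^sub>R s)))" if "h \<in> V" for h
      using null[OF that] s(1)
      by (simp add: matrix_vector_mult_scaleR matrix_vector_mult_diff_rdistrib inner_diff_right
          scaleR_matrix_vector_assoc[symmetric] field_simps)
  qed
qed

text \<open>The induction picks the next vector in the \<open>A\<close>-orthogonal complement \<open>V\<close> of the previous ones.
  The eigenvector equation is required against all \<open>h\<close> and not only against \<open>V\<close>:
  this is what carries \<open>B\<close>-orthogonality from one step to the next.\<close>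
lemma relative_eigenvector_family:
  fixes A B :: "real ^ 'm ^ 'm" and S :: "'m set"
  assumes A: "pos_definite A" and B: "transpose B = B"
  shows "\<exists>u l. \<forall>i\<in>S. (\<forall>h. h \<bullet> (B *v u i) = l i * (h \<bullet> (A *v u i))) \<and>
     (\<forall>j\<in>S. u i \<bullet> (A *v u j) = (if i = j then 1 else 0))"
proof (induction S rule: infinite_finite_induct)
  case (insert k S)
  then obtain u :: "'m \<Rightarrow> real ^ 'm" and l where
    eig: "\<And>i h. i \<in> S \<Longrightarrow> h \<bullet> (B *v u i) = l i * (h \<bullet> (A *v u i))" and
    orth: "\<And>i j. i \<in> S \<Longrightarrow> j \<in> S \<Longrightarrow> u i \<bullet> (A *v u j) = (if i = j then 1 else 0)" by metis
  have As: "transpose A = A" using A by (simp add: pos_definite_def)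
  define V where "V = {x. \<forall>i\<in>S. x \<bullet> (A *v u i) = 0}"
  have V: "subspace V" by (auto simp: V_def subspace_def inner_add_left)
  have "dim ((\<lambda>i. A *v u i) ` S) \<le> card ((\<lambda>i. A *v u i) ` S)"
    by (intro dim_le_card' finite_imageI insert.hyps)
  also have "\<dots> \<le> card S" using insert.hyps by (intro card_image_le)
  also have "\<dots> < card (UNIV :: 'm set)" using insert.hyps by (intro psubset_card_mono) auto
  finally have "dim ((\<lambda>i. A *v u i) ` S) < DIM(real ^ 'm)" by simp
  then obtain x0 where "x0 \<noteq> 0" "\<And>y. y \<in> span ((\<lambda>i. A *v u i) ` S) \<Longrightarrow> orthogonal x0 y"
    using orthogonal_to_subspace_exists by blast
  then have "x0 \<in> V" "x0 \<noteq> 0" by (auto simp: V_def orthogonal_def span_base)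
  then have "V \<noteq> {0}" by blast
  then obtain x m where x: "x \<in> V" "x \<bullet> (A *v x) = 1"
    and xeig: "\<And>h. h \<in> V \<Longrightarrow> h \<bullet> (B *v x) = m * (h \<bullet> (A *v x))"
    using exists_relative_eigenvector[OF A B V] by metis
  have xA: "x \<bullet> (A *v u i) = 0" "u i \<bullet> (A *v x) = 0" "x \<bullet> (B *v u i) = 0" "u i \<bullet> (B *v x) = 0"
    if "i \<in> S" for i
    using x(1) that eig[OF that, of x] symmetric_matrix_inner[OF As, of x "u i"]
      symmetric_matrix_inner[OF B, of x "u i"] by (auto simp: V_def)
  have xall: "h \<bullet> (B *v x) = m * (h \<bullet> (A *v x))" for h
  proof -
    \<comment> \<open>the \<open>A\<close>-orthogonal projection of \<open>h\<close> to \<open>V\<close>; what it removes pairs to zero with \<open>x\<close> in both forms\<close>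
    define g where "g = h - (\<Sum>i\<in>S. (h \<bullet> (A *v u i)) *\<^sub>R u i)"
    have "g \<in> V"
      using insert.hyps by (simp add: V_def g_def inner_diff_left inner_sum_left orth if_distrib cong: if_cong)
    from xeig[OF this] show ?thesis
      by (simp add: g_def inner_diff_left inner_sum_left xA)
  qed
  have neq: "i \<noteq> k" if "i \<in> S" for i using insert.hyps that by blast
  show ?case
  proof (intro exI[of _ "u(k := x)"] exI[of _ "l(k := m)"] ballI conjI allI)
    fix i h assume "i \<in> insert k S"
    then show "h \<bullet> (B *v (u(k := x)) i) = (l(k := m)) i * (h \<bullet> (A *v (u(k := x)) i))"
      by (cases "i = k") (simp_all add: xall eig)
  next
    fix i j assume "i \<in> insert k S" "j \<in> insert k S"
    then show "(u(k := x)) i \<bullet> (A *v (u(k := x)) j) = (if i = j then 1 else 0)"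
      using neq[of i] neq[of j] by (cases "i = k"; cases "j = k") (simp_all add: x xA orth)
  qed
qed auto

lemma congruence_entry:
  fixes R C :: "real ^ 'm ^ 'm"
  shows "(R ** C ** transpose R) $ i $ j = R $ i \<bullet> (C *v R $ j)"
  unfolding matrix_matrix_mult_def matrix_vector_mult_def transpose_def inner_vec_def
  by (simp add: sum_distrib_left sum_distrib_right mult.assoc) (rule sum.swap)

theorem simultaneous_diagonalization:
  fixes A B :: "real ^ 'm ^ 'm"
  assumes "pos_definite A" and "transpose B = B"
  obtains R :: "real ^ 'm ^ 'm" and l where
    "R ** A ** transpose R = mat 1"
    "R ** B ** transpose R = (\<chi> i j. if i = j then l i else 0)"
proof -
  obtain u :: "'m \<Rightarrow> real ^ 'm" and l where u: "\<And>i h. h \<bullet> (B *v u i) = l i * (h \<bullet> (A *v u i))"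
     "\<And>i j. u i \<bullet> (A *v u j) = (if i = j then 1 else 0)"
    using relative_eigenvector_family[OF assms, of UNIV] by (metis UNIV_I)
  show ?thesis
    by (rule that[of "\<chi> i. u i" l]) (auto simp: vec_eq_iff congruence_entry u mat_def)
qed

text \<open>Along every linear combination of \<open>A\<close> and \<open>B\<close> the determinant is a product of linear factors, up
  to the constant factor \<open>(det R)\<^sup>2\<close>.\<close>
lemma det_congruence:
  fixes R A B :: "real ^ 'm ^ 'm"
  assumes RA: "R ** A ** transpose R = mat 1"
    and RB: "R ** B ** transpose R = (\<chi> i j. if i = j then l i else 0)"
  shows "(det R)\<^sup>2 * det (s *\<^sub>R A + t *\<^sub>R B) = (\<Prod>i\<in>UNIV. s + t * l i)"
proof -
  have "R ** (s *\<^sub>R A + t *\<^sub>R B) ** transpose R = (\<chi> i j. if i = j then s + t * l i else 0)"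
  proof -
    have "R $ i \<bullet> (A *v R $ j) = (if i = j then 1 else 0)"
      "R $ i \<bullet> (B *v R $ j) = (if i = j then l i else 0)" for i j
      using RA RB by (auto simp: congruence_entry[symmetric] mat_def)
    then show ?thesis
      by (simp add: vec_eq_iff congruence_entry matrix_vector_mult_add_rdistrib inner_add_right
          scaleR_matrix_vector_assoc[symmetric])
  qed
  from arg_cong[OF this, of det] show ?thesis
    by (simp add: det_mul det_diagonal power2_eq_square mult_ac)
qed

section \<open>Determinants on the cone of positive definite matrices\<close>

lemma pos_definite_det_pos:
  fixes A :: "real ^ 'm ^ 'm"
  assumes "pos_definite A"
  shows "det A > 0"
proof -
  have "transpose A = A" using assms by (simp add: pos_definite_def)
  from simultaneous_diagonalization[OF assms this]
  obtain R :: "real ^ 'm ^ 'm" where "R ** A ** transpose R = mat 1" .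
  then have "det (R ** A ** transpose R) = 1" by simp
  then have "(det R)\<^sup>2 * det A = 1" by (simp add: det_mul power2_eq_square mult_ac)
  then have "0 < (det R)\<^sup>2 * det A" by simp
  then show ?thesis by (simp add: zero_less_mult_iff)
qed

text \<open>For a semidefinite matrix an isotropic vector is a kernel vector.\<close>
lemma pos_definite_if_semidefinite_det_nonzero:
  fixes A :: "real ^ 'm ^ 'm"
  assumes sym: "transpose A = A" and psd: "\<And>u. 0 \<le> u \<bullet> (A *v u)" and "det A \<noteq> 0"
  shows "pos_definite A"
  unfolding pos_definite_def
proof (intro conjI allI impI sym)
  fix u :: "real ^ 'm" assume "u \<noteq> 0"
  show "0 < u \<bullet> (A *v u)"
  proof (rule ccontr)
    assume "\<not> ?thesis"
    then have "u \<bullet> (A *v u) = 0" using psd[of u] by simp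
    then have "h \<bullet> (A *v u) = 0" for h
      using semidefinite_null_vector[OF sym subspace_UNIV] psd by blast
    then have "A *v u = 0" by (metis inner_eq_zero_iff)
    then show False
      using \<open>det A \<noteq> 0\<close> \<open>u \<noteq> 0\<close> inj_matrix_vector_mult[of A] invertible_det_nz[of A]
      by (metis injD matrix_vector_mult_0_right)
  qed
qed

text \<open>Midpoint form of the strict concavity of \<open>log det\<close>. In diagonal form it is the inequality
  \<open>l \<le> ((1 + l) / 2)\<^sup>2\<close> for each factor, with equality only for \<open>l = 1\<close>; if all \<open>l i\<close>
  are \<open>1\<close>, then \<open>A = B\<close>.\<close>
lemma det_midpoint_strict:
  fixes A B :: "real ^ 'm ^ 'm"
  assumes A: "pos_definite A" and B: "pos_definite B" and "A \<noteq> B"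
  shows "det A * det B < (det ((1/2) *\<^sub>R A + (1/2) *\<^sub>R B))\<^sup>2"
proof -
  have "transpose B = B" using B by (simp add: pos_definite_def)
  from simultaneous_diagonalization[OF A this]
  obtain R :: "real ^ 'm ^ 'm" and l where R: "R ** A ** transpose R = mat 1"
    "R ** B ** transpose R = (\<chi> i j. if i = j then l i else 0)" .
  note det = det_congruence[OF R]
  have dA: "(det R)\<^sup>2 * det A = 1" using det[of 1 0] by simp
  then have dR: "det R \<noteq> 0" by auto
  then obtain R' where R': "R' ** R = mat 1"
    by (metis invertible_det_nz invertible_def)
  have dB: "(det R)\<^sup>2 * det B = (\<Prod>i\<in>UNIV. l i)" using det[of 0 1] by simp
  have lpos: "l i > 0" for i
  proof -
    have "(R ** B ** transpose R) $ i $ i = l i" by (simp add: R)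
    then have "R $ i \<bullet> (B *v R $ i) = l i" by (simp add: congruence_entry)
    moreover have "R $ i \<noteq> 0"
      using congruence_entry[of R A i i] by (auto simp: R mat_def)
    ultimately show ?thesis using B unfolding pos_definite_def by metis
  qed
  have "\<exists>k. l k \<noteq> 1"
  proof (rule ccontr)
    assume "\<not> ?thesis"
    then have "R ** A ** transpose R = R ** B ** transpose R"
      by (simp add: R mat_def vec_eq_iff)
    then have eq: "R' ** (R ** A ** transpose R) ** transpose R' = R' ** (R ** B ** transpose R) ** transpose R'"
      by simp
    have tR': "transpose R ** transpose R' = mat 1"
      by (simp add: matrix_transpose_mul[symmetric] R')
    have "R' ** (R ** C ** transpose R) ** transpose R' = (R' ** R) ** C ** (transpose R ** transpose R')"
      for C :: "real ^ 'm ^ 'm" by (simp only: matrix_mul_assoc)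
    then have "A = B" using eq by (simp add: R' tR')
    then show False using \<open>A \<noteq> B\<close> by contradiction
  qed
  then obtain k where k: "l k \<noteq> 1" ..
  have "(\<Prod>i\<in>UNIV. l i) < (\<Prod>i\<in>UNIV. ((1 + l i) / 2)\<^sup>2)"
  proof (rule prod_mono_strict[of k])
    have sq: "((1 + l i) / 2)\<^sup>2 = l i + ((l i - 1) / 2)\<^sup>2" for i
      by (simp add: power2_eq_square field_simps)
    show "l k < ((1 + l k) / 2)\<^sup>2" using k by (simp add: sq)
    show "0 \<le> l i \<and> l i \<le> ((1 + l i) / 2)\<^sup>2" for i using lpos[of i] by (simp add: sq)
    show "0 < ((1 + l i) / 2)\<^sup>2" for i using lpos[of i] by simp
  qed auto
  also have "\<dots> = ((det R)\<^sup>2 * det ((1/2) *\<^sub>R A + (1/2) *\<^sub>R B))\<^sup>2"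
    unfolding det prod_power_distrib by (simp add: add_divide_distrib)
  finally have "((det R)\<^sup>2 * det A) * ((det R)\<^sup>2 * det B) < \<dots>"
    unfolding dA dB by simp
  then have "((det R)\<^sup>2)\<^sup>2 * (det A * det B) <
      ((det R)\<^sup>2)\<^sup>2 * (det ((1/2) *\<^sub>R A + (1/2) *\<^sub>R B))\<^sup>2"
    by (simp only: power2_eq_square mult_ac)
  moreover have "0 < ((det R)\<^sup>2)\<^sup>2" using dR by simp
  ultimately show ?thesis by (simp only: mult_less_cancel_left_pos)
qed

lemma matrix_inv_eqI:
  fixes A B :: "real ^ 'm ^ 'm"
  assumes "A ** B = mat 1"
  shows "matrix_inv A = B"
proof -
  have "A ** matrix_inv A = mat 1 \<and> matrix_inv A ** A = mat 1"
    unfolding matrix_inv_def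
    by (rule someI[of _ B]) (use assms matrix_left_right_inverse in blast)
  then have "matrix_inv A ** (A ** B) = B" by (simp add: matrix_mul_assoc)
  then show ?thesis by (simp add: assms)
qed

text \<open>In diagonal form \<open>trace (matrix_inv A ** B)\<close> is the sum of the \<open>l i\<close>, and the determinant along
  the segment has the derivative \<open>\<Sum>i. l i - 1\<close> at its start, up to a positive factor. At a
  maximum this derivative is not positive.\<close>
lemma trace_inverse_le_if_det_maximal:
  fixes A B :: "real ^ 'm ^ 'm"
  assumes A: "pos_definite A" and B: "transpose B = B" 
    and max: "\<And>t. 0 \<le> t \<Longrightarrow> t \<le> 1 \<Longrightarrow> det ((1 - t) *\<^sub>R A + t *\<^sub>R B) \<le> det A"
  shows "trace (matrix_inv A ** B) \<le> real CARD('m)"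
proof -
  from simultaneous_diagonalization[OF A B]
  obtain R :: "real ^ 'm ^ 'm" and l where R: "R ** A ** transpose R = mat 1"
    "R ** B ** transpose R = (\<chi> i j. if i = j then l i else 0)" .
  note det = det_congruence[OF R]
  have "A ** (transpose R ** R) = mat 1"
    using R(1) by (metis matrix_left_right_inverse matrix_mul_assoc)
  then have "matrix_inv A = transpose R ** R" by (rule matrix_inv_eqI)
  then have "trace (matrix_inv A ** B) = trace (R ** B ** transpose R)"
    by (metis matrix_mul_assoc trace_mul_sym)
  also have "\<dots> = (\<Sum>i\<in>UNIV. l i)" by (simp add: R trace_def)
  finally have tr: "trace (matrix_inv A ** B) = (\<Sum>i\<in>UNIV. l i)" .
  define \<phi> where "\<phi> t = (\<Prod>i\<in>UNIV. (1 - t) + t * l i)" for t :: real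
  have le: "\<phi> t \<le> 1" if "0 \<le> t" "t \<le> 1" for t
    using mult_left_mono[OF max[OF that], of "(det R)\<^sup>2"] det[of "1 - t" t] det[of 1 0]
    by (simp add: \<phi>_def)
  have "(\<phi> has_field_derivative (\<Sum>i\<in>UNIV. l i - 1)) (at 0)"
    unfolding \<phi>_def
    by (rule DERIV_cong, rule has_field_derivative_prod[where f' = "\<lambda>i. l i - 1"])
      (auto intro!: derivative_eq_intros)
  then have "\<not> 0 < (\<Sum>i\<in>UNIV. l i - 1)"
  proof (intro notI)
    assume "(\<phi> has_field_derivative (\<Sum>i\<in>UNIV. l i - 1)) (at 0)" "0 < (\<Sum>i\<in>UNIV. l i - 1)"
    then obtain e where e: "e > 0" "\<And>h. 0 < h \<Longrightarrow> h < e \<Longrightarrow> \<phi> 0 < \<phi> (0 + h)"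
      using DERIV_pos_inc_right by metis
    have "\<phi> 0 < \<phi> (min 1 (e / 2))" using e(1) e(2)[of "min 1 (e / 2)"] by (simp add: min_def)
    with le[of "min 1 (e / 2)"] e(1) show False by (simp add: \<phi>_def min_def split: if_splits)
  qed
  then show ?thesis by (simp add: tr sum_subtractf)
qed

section \<open>Moment matrices of polynomial bases\<close>

lemma moment_matrix_linear: "linear (moment_matrix v w)"
  unfolding moment_matrix_def
  by (rule linearI) (simp_all add: scaleR_left_distrib sum.distrib scaleR_sum_right)

lemma moment_matrix_point:
  assumes "poly_basis d v" "poly_basis (2 * d) w"
  shows "moment_matrix v w (w x) = outer (v x)"
  using moment_basis_eq[OF assms, of x] by (simp add: moment_matrix_def)

lemma outer_mult: "outer u *v x = (u \<bullet> x) *\<^sub>R u"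
  by (simp add: outer_def matrix_vector_mult_def inner_vec_def vec_eq_iff sum_distrib_left mult_ac)

lemma trace_mult_outer:
  fixes A :: "real ^ 'm ^ 'm"
  shows "trace (A ** outer u) = u \<bullet> (A *v u)"
  by (simp add: trace_def outer_def matrix_matrix_mult_def matrix_vector_mult_def inner_vec_def
      sum_distrib_left mult_ac)

text \<open>Every monomial of degree at most \<open>2 * d\<close> is a product of two monomials of degree at most \<open>d\<close>; this
  is the combinatorial reason for the injectivity of the moment matrix.\<close>
lemma split_multiindex:
  fixes e :: "'n::finite \<Rightarrow> nat"
  assumes "k \<le> (\<Sum>i\<in>UNIV. e i)"
  shows "\<exists>e'. (\<forall>i. e' i \<le> e i) \<and> (\<Sum>i\<in>UNIV. e' i) = k"
  using assms
proof (induction k)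
  case 0
  show ?case by (intro exI[of _ "\<lambda>_. 0"]) simp
next
  case (Suc k)
  then obtain e' where e': "\<forall>i. e' i \<le> e i" "sum e' UNIV = k" by auto
  have "\<exists>i. e' i < e i"
  proof (rule ccontr)
    assume "\<not> ?thesis"
    then have "sum e UNIV \<le> sum e' UNIV" by (intro sum_mono) (simp add: not_less)
    then show False using Suc.prems e' by simp
  qed
  then obtain j where j: "e' j < e j" ..
  have "sum (e'(j := Suc (e' j))) UNIV = Suc k"
    using e'(2) by (simp add: sum.remove[of UNIV j])
  then show ?case using e' j by (intro exI[of _ "e'(j := Suc (e' j))"]) auto
qed

text \<open>A vector \<open>z\<close> acts on polynomials of degree at most \<open>2 * d\<close> by sending \<open>c \<bullet> w\<close> to \<open>c \<bullet> z\<close>.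
  On the product of \<open>c1 \<bullet> v\<close> and \<open>c2 \<bullet> v\<close> this action is the bilinear form of the moment
  matrix of \<open>z\<close>. If that matrix is zero, then \<open>z\<close> kills all monomials, hence the coordinates of \<open>w\<close>.\<close>
lemma moment_matrix_inj:
  fixes v :: "real ^ 'n::finite \<Rightarrow> real ^ 'm::finite" and w :: "real ^ 'n \<Rightarrow> real ^ 'q::finite"
  assumes v: "poly_basis d v" and w: "poly_basis (2 * d) w"
  shows "inj (moment_matrix v w)"
proof (rule linear_injective_0[OF moment_matrix_linear, THEN iffD2], intro allI impI)
  fix z assume z: "moment_matrix v w z = 0"
  have mono: "\<exists>c. c \<bullet> z = 0 \<and> (\<forall>x. monomial_fun e x = c \<bullet> w x)"
    if e: "e \<in> exponents (2 * d)" for e :: "'n \<Rightarrow> nat"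
  proof -
    obtain e1 where e1: "\<forall>i. e1 i \<le> e i" "sum e1 UNIV = min d (sum e UNIV)"
      using split_multiindex[of "min d (sum e UNIV)" e] by auto
    define e2 where "e2 i = e i - e1 i" for i
    have ee: "e i = e1 i + e2 i" for i using e1(1) by (simp add: e2_def)
    have "sum e UNIV = sum e1 UNIV + sum e2 UNIV" by (simp add: ee sum.distrib)
    then have "e1 \<in> exponents d" "e2 \<in> exponents d"
      using e e1(2) by (auto simp: exponents_def)
    then obtain c1 c2 where c: "\<And>x. monomial_fun e1 x = c1 \<bullet> v x" "\<And>x. monomial_fun e2 x = c2 \<bullet> v x"
      using v monomial_in_polys unfolding poly_basis_def by metis
    define c where "c = (\<chi> \<alpha>. c1 \<bullet> (moment_basis v w \<alpha> *v c2))"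
    have cM: "c1 \<bullet> (moment_matrix v w y *v c2) = c \<bullet> y" for y
    proof -
      have "moment_matrix v w y *v c2 = (\<Sum>\<alpha>\<in>UNIV. y $ \<alpha> *\<^sub>R (moment_basis v w \<alpha> *v c2))"
      proof -
        have lin: "linear (\<lambda>B :: real ^ 'm ^ 'm. B *v c2)"
          by (rule linearI) (simp_all add: matrix_vector_mult_add_rdistrib scaleR_matrix_vector_assoc)
        show ?thesis by (simp only: moment_matrix_def linear_sum[OF lin] linear_scale[OF lin])
      qed
      then show ?thesis by (simp add: c_def inner_sum_right inner_vec_def[of "vec_lambda _"] mult.commute)
    qed
    have "monomial_fun e x = c \<bullet> w x" for x
    proof -
      have "monomial_fun e x = monomial_fun e1 x * monomial_fun e2 x"
        by (simp add: monomial_fun_def ee power_add prod.distrib)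
      also have "\<dots> = c1 \<bullet> (moment_matrix v w (w x) *v c2)"
        by (simp add: c moment_matrix_point[OF v w] outer_mult inner_commute)
      finally show ?thesis by (simp add: cM)
    qed
    moreover have "c \<bullet> z = 0" using cM[of z] z by simp
    ultimately show ?thesis by blast
  qed
  then obtain k where k: "\<And>e. e \<in> exponents (2 * d) \<Longrightarrow> k e \<bullet> z = 0"
    "\<And>e x. e \<in> exponents (2 * d) \<Longrightarrow> monomial_fun e x = k e \<bullet> w x" by metis
  have "z $ i = 0" for i
  proof -
    have "(\<lambda>x. w x $ i) \<in> polys (2 * d)" using w by (simp add: poly_basis_def)
    then obtain c where c: "\<And>x. w x $ i = (\<Sum>e\<in>exponents (2 * d). c e * monomial_fun e x)"
      by (auto simp: polys_def)
    define b where "b = (\<Sum>e\<in>exponents (2 * d). c e *\<^sub>R k e)"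
    have "(axis i 1 - b) \<bullet> w x = 0" for x
      by (simp add: inner_diff_left inner_axis' c b_def inner_sum_left k(2))
    then have "axis i 1 = b" using w unfolding poly_basis_def by (metis eq_iff_diff_eq_0)
    then have "z $ i = b \<bullet> z" by (metis inner_axis' inner_real_def mult_1)
    also have "\<dots> = 0" by (simp add: b_def inner_sum_left k(1))
    finally show ?thesis .
  qed
  then show "z = 0" by (simp add: vec_eq_iff)
qed

text \<open>The restriction of \<open>f\<close> to the line through \<open>x\<close> and an interior point of \<open>S\<close> is a polynomial in one
  variable with infinitely many roots.\<close>
lemma real_polynomial_function_zero_on_open:
  fixes f :: "'a::euclidean_space \<Rightarrow> real"
  assumes f: "real_polynomial_function f" and "interior S \<noteq> {}" and zero: "\<And>x. x \<in> S \<Longrightarrow> f x = 0"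
  shows "f x = 0"
proof -
  obtain x0 where "x0 \<in> interior S" using assms by blast
  then obtain r where r: "r > 0" "ball x0 r \<subseteq> S" by (meson mem_interior)
  define g where "g t = x0 + t *\<^sub>R (x - x0)" for t :: real
  have "polynomial_function g"
    unfolding g_def by (intro polynomial_function_add polynomial_function_const polynomial_function_mult polynomial_function_id)
  then have "real_polynomial_function (f \<circ> g)" using f by (rule real_polynomial_function_compose)
  then obtain c :: "nat \<Rightarrow> real" and n where c: "f \<circ> g = (\<lambda>t. \<Sum>i\<le>n. c i * t ^ i)"
    using real_polynomial_function_iff_sum[of "f \<circ> g"] by blast
  \<comment> \<open>adding \<open>1\<close> to the norm keeps the denominator positive when \<open>x = x0\<close>\<close>
  define e where "e = r / (norm (x - x0) + 1)"
  have e: "e > 0" using r by (simp add: e_def add_nonneg_pos)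
  have "f (g t) = 0" if "t \<in> {0<..<e}" for t
  proof (rule zero, rule subsetD[OF r(2)])
    have "\<bar>t\<bar> * norm (x - x0) \<le> t * (norm (x - x0) + 1)" using that by simp
    also have "\<dots> < e * (norm (x - x0) + 1)" using that by (intro mult_strict_right_mono) (auto simp: add_nonneg_pos)
    also have "\<dots> = r" by (simp add: e_def add_nonneg_eq_0_iff)
    finally show "g t \<in> ball x0 r" by (simp add: g_def dist_norm)
  qed
  then have "{0<..<e} \<subseteq> {t. (\<Sum>i\<le>n. c i * t ^ i) = 0}"
    using c by (auto simp: fun_eq_iff)
  moreover have "infinite {0<..<e}" using e by (simp add: infinite_Ioo)
  ultimately have "infinite {t. (\<Sum>i\<le>n. c i * t ^ i) = 0}" using finite_subset by blast
  then have "\<forall>i\<le>n. c i = 0" using Transcendental.polyfun_finite_roots[where c = c and n = n] by blast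
  then have "(f \<circ> g) 1 = 0" unfolding c by simp
  then show ?thesis by (simp add: g_def)
qed

lemma poly_basis_continuous:
  assumes "poly_basis k w"
  shows "continuous_on S w"
proof -
  have "continuous_on S (\<lambda>x. w x $ i)" for i
    using assms real_polynomial_function_iff_polys continuous_real_polymonial_function
    unfolding poly_basis_def by (metis continuous_at_imp_continuous_on)
  then have "continuous_on S (\<lambda>x. \<chi> i. w x $ i)" by (rule continuous_on_vec_lambda)
  then show ?thesis by simp
qed

section \<open>Moment vectors of probability measures as convex combinations\<close>

text \<open>A convex combination of points \<open>w x\<close> is the moment vector of the corresponding weights on
  finitely many points \<open>x\<close>, realized as the push-forward of a measure on the finite set of
  the values \<open>w x\<close>.\<close>
lemma convex_hull_subset_moment_cone:
  fixes w :: "real ^ 'n::finite \<Rightarrow> real ^ 'm::finite"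
  assumes cont: "continuous_on K w"
  shows "convex hull (w ` K) \<subseteq> moment_cone w K"
proof
  fix y assume "y \<in> convex hull (w ` K)"
  then obtain S u where S: "finite S" "S \<subseteq> w ` K" "\<And>s. s \<in> S \<Longrightarrow> 0 \<le> u s" "(\<Sum>s\<in>S. u s *\<^sub>R s) = y"
    by (auto simp: convex_hull_explicit)
  define x where "x s = inv_into K w s" for s
  have x: "x s \<in> K" "w (x s) = s" if "s \<in> S" for s
    using that S(2) by (auto simp: x_def inv_into_into f_inv_into_f subset_eq)
  define \<mu> where "\<mu> = distr (point_measure S u) (restrict_space borel K) x"
  have meas: "x \<in> measurable (point_measure S u) (restrict_space borel K)"
    using x(1) by (auto simp: measurable_point_measure_eq1 space_restrict_space)
  have wm: "w \<in> borel_measurable (restrict_space borel K)"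
    using cont by (rule borel_measurable_continuous_on_restrict)
  have int: "integrable (point_measure S u) (\<lambda>s. w (x s))"
    by (rule integrable_point_measure_finite) fact
  have "integrable \<mu> w" unfolding \<mu>_def integrable_distr_eq[OF meas wm] by (rule int)
  moreover have "y = (\<integral>x. w x \<partial>\<mu>)"
    unfolding \<mu>_def integral_distr[OF meas wm]
    using S x by (simp add: lebesgue_integral_point_measure_finite)
  moreover have "sets \<mu> = sets (restrict_space borel K)" by (simp add: \<mu>_def)
  ultimately show "y \<in> moment_cone w K" unfolding moment_cone_def by blast
qed

text \<open>Integrating a strict separating inequality \<open>b < h \<bullet> w x\<close> against a probability measure
  shows that a moment vector cannot be separated from the closed convex hull. That the total mass is
  one is the assumption \<open>a \<bullet> y = 1\<close>, as \<open>a \<bullet> w\<close> is the constant \<open>1\<close> on \<open>K\<close>.\<close>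
lemma probability_moments_eq_convex_hull:
  fixes w :: "real ^ 'n::finite \<Rightarrow> real ^ 'm::finite"
  assumes K: "compact K" and cont: "continuous_on K w" and a: "\<And>x. x \<in> K \<Longrightarrow> a \<bullet> w x = 1"
  shows "{y. y \<in> moment_cone w K \<and> a \<bullet> y = 1} = convex hull (w ` K)"
proof (intro subset_antisym subsetI)
  fix y assume y: "y \<in> convex hull (w ` K)"
  have "convex hull (w ` K) \<subseteq> {y. a \<bullet> y = 1}"
    by (rule hull_minimal) (auto simp: a convex_hyperplane)
  then show "y \<in> {y. y \<in> moment_cone w K \<and> a \<bullet> y = 1}"
    using y convex_hull_subset_moment_cone[OF cont] by blast
next
  fix y assume "y \<in> {y. y \<in> moment_cone w K \<and> a \<bullet> y = 1}"
  then obtain \<mu> where sets: "sets \<mu> = sets (restrict_space borel K)" and int: "integrable \<mu> w"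
    and y: "y = (\<integral>x. w x \<partial>\<mu>)" and ay: "a \<bullet> y = 1"
    by (auto simp: moment_cone_def)
  have space: "space \<mu> = K" using sets_eq_imp_space_eq[OF sets] by (simp add: space_restrict_space)
  have inner: "integrable \<mu> (\<lambda>x. h \<bullet> w x)" "(\<integral>x. h \<bullet> w x \<partial>\<mu>) = h \<bullet> y" for h
    using int by (simp_all add: y)
  have int1: "integrable \<mu> (\<lambda>x. 1 :: real)"
    using inner(1)[of a] by (subst Bochner_Integration.integrable_cong[where g = "\<lambda>x. a \<bullet> w x"]) (auto simp: space a)
  have one: "(\<integral>x. 1 \<partial>\<mu>) = (1 :: real)"
    using inner(2)[of a] ay by (subst Bochner_Integration.integral_cong[where g = "\<lambda>x. a \<bullet> w x"]) (auto simp: space a)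
  show "y \<in> convex hull (w ` K)"
  proof (rule ccontr)
    assume "y \<notin> convex hull (w ` K)"
    moreover have "closed (convex hull (w ` K))"
      using K cont by (intro compact_imp_closed compact_convex_hull compact_continuous_image)
    ultimately obtain h b where h: "h \<bullet> y < b" "\<And>z. z \<in> convex hull (w ` K) \<Longrightarrow> b < h \<bullet> z"
      using separating_hyperplane_closed_point[OF convex_convex_hull] by blast
    have "b = (\<integral>x. b * 1 \<partial>\<mu>)" using one by (subst integral_mult_right_zero) simp
    also have "\<dots> \<le> (\<integral>x. h \<bullet> w x \<partial>\<mu>)"
      using inner(1) h(2)
      by (intro integral_mono integrable_mult_right int1) (auto simp: space hull_inc less_imp_le)
    finally show False using h(1) by (simp add: inner)
  qed
qed

text \<open>If a convex combination attains the upper bound \<open>m\<close> of a linear functional, then so does every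
  point of positive weight.\<close>
lemma convex_hull_supporting_face:
  fixes L :: "'a::real_vector \<Rightarrow> real"
  assumes L: "linear L" and le: "\<And>x. x \<in> P \<Longrightarrow> L x \<le> m"
    and y: "y \<in> convex hull P" "L y = m"
  shows "y \<in> convex hull {x \<in> P. L x = m}"
proof -
  obtain S u where S: "finite S" "S \<subseteq> P" "\<And>s. s \<in> S \<Longrightarrow> 0 \<le> u s" "sum u S = 1"
    "(\<Sum>s\<in>S. u s *\<^sub>R s) = y"
    using y(1) by (auto simp: convex_hull_explicit)
  have "(\<Sum>s\<in>S. u s * (m - L s)) = 0"
    using S(4,5) y(2) linear_sum[OF L, of "\<lambda>s. u s *\<^sub>R s" S] linear_scale[OF L]
    by (simp add: right_diff_distrib sum_subtractf sum_distrib_right[symmetric])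
  moreover have "\<forall>s\<in>S. 0 \<le> u s * (m - L s)" using S(2,3) le by fastforce
  ultimately have "\<forall>s\<in>S. u s * (m - L s) = 0"
    using sum_nonneg_eq_0_iff[OF S(1), of "\<lambda>s. u s * (m - L s)"] by blast
  then have zero: "u s = 0 \<or> L s = m" if "s \<in> S" for s using that by auto
  let ?T = "{s \<in> S. L s = m}"
  have "sum u ?T = sum u S" "(\<Sum>s\<in>?T. u s *\<^sub>R s) = (\<Sum>s\<in>S. u s *\<^sub>R s)"
    using S(1) by (auto intro!: sum.mono_neutral_left dest: zero)
  then show ?thesis
    unfolding convex_hull_explicit using S
    by (intro CollectI exI[of _ ?T] exI[of _ u]) auto
qed

section \<open>Positivity of moment matrices\<close>

lemma moment_matrix_semidefinite:
  assumes v: "poly_basis d v" and w: "poly_basis (2 * d) w" and y: "y \<in> convex hull (w ` X)"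
  shows "transpose (moment_matrix v w y) = moment_matrix v w y"
    and "0 \<le> u \<bullet> (moment_matrix v w y *v u)"
proof -
  note lin = linear_add[OF moment_matrix_linear] linear_scale[OF moment_matrix_linear]
  let ?P = "{y. transpose (moment_matrix v w y) = moment_matrix v w y \<and>
      (\<forall>u. 0 \<le> u \<bullet> (moment_matrix v w y *v u))}"
  have "convex hull (w ` X) \<subseteq> ?P"
  proof (rule hull_minimal)
    show "w ` X \<subseteq> ?P"
      by (auto simp: moment_matrix_point[OF v w] outer_mult inner_commute)
        (simp add: outer_def transpose_def mult.commute)
    show "convex ?P"
      by (rule convexI)
        (auto simp: lin matrix_vector_mult_add_rdistrib inner_add_right transpose_def vec_eq_iff
          scaleR_matrix_vector_assoc[symmetric])
  qed
  then show "transpose (moment_matrix v w y) = moment_matrix v w y"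
    "0 \<le> u \<bullet> (moment_matrix v w y *v u)" using y by auto
qed

text \<open>For fixed \<open>u\<close> the map \<open>z \<mapsto> u \<bullet> (moment_matrix v w z *v u)\<close> is linear and nonnegative on the
  hull, and a zero at a relative interior point forces it to vanish on the whole hull. Its value at
  \<open>w x\<close> is \<open>(u \<bullet> v x)\<^sup>2\<close>, so \<open>u \<bullet> v\<close> vanishes on \<open>X\<close> and \<open>u = 0\<close>.\<close>
lemma exists_pos_definite_moment_matrix:
  assumes v: "poly_basis d v" and w: "poly_basis (2 * d) w" and X: "interior X \<noteq> {}"
  shows "\<exists>y\<in>convex hull (w ` X). pos_definite (moment_matrix v w y)"
proof -
  note lin = linear_add[OF moment_matrix_linear] linear_scale[OF moment_matrix_linear]
  let ?C = "convex hull (w ` X)"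
  have "?C \<noteq> {}" using X interior_subset by fastforce
  then obtain y where y: "y \<in> rel_interior ?C"
    using rel_interior_eq_empty[OF convex_convex_hull] by blast
  then have yC: "y \<in> ?C" using rel_interior_subset by blast
  have "pos_definite (moment_matrix v w y)"
    unfolding pos_definite_def
  proof (intro conjI allI impI)
    show "transpose (moment_matrix v w y) = moment_matrix v w y"
      by (rule moment_matrix_semidefinite[OF v w yC])
    fix u :: "real ^ 'b" assume "u \<noteq> 0"
    show "0 < u \<bullet> (moment_matrix v w y *v u)"
    proof (rule ccontr)
      assume "\<not> ?thesis"
      then have zero: "u \<bullet> (moment_matrix v w y *v u) = 0"
        using moment_matrix_semidefinite(2)[OF v w yC, of u] by simp
      have "u \<bullet> v x = 0" if x: "x \<in> X" for x
      proof -
        \<comment> \<open>the segment from \<open>w x\<close> to \<open>y\<close> can be prolonged beyond \<open>y\<close> inside the hull\<close>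
        have "w x \<in> affine hull ?C" using x by (simp add: hull_inc)
        then obtain e where e: "e > 1" "(1 - e) *\<^sub>R w x + e *\<^sub>R y \<in> ?C"
          using convex_rel_interior_if2[OF convex_convex_hull y] by blast
        from moment_matrix_semidefinite(2)[OF v w e(2), of u]
        have "0 \<le> (1 - e) * (u \<bullet> v x)\<^sup>2"
          by (simp add: lin matrix_vector_mult_add_rdistrib inner_add_right zero
              scaleR_matrix_vector_assoc[symmetric] moment_matrix_point[OF v w] outer_mult
              inner_commute power2_eq_square)
        then show ?thesis using e(1) by (simp add: zero_le_mult_iff)
      qed
      moreover have "real_polynomial_function (\<lambda>x. u \<bullet> v x)"
      proof -
        have "(\<lambda>x. \<Sum>i\<in>UNIV. u $ i * v x $ i) \<in> polys d"
          using v by (intro polys_sum polys_cmult) (simp add: poly_basis_def)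
        then show ?thesis by (auto simp: real_polynomial_function_iff_polys inner_vec_def)
      qed
      ultimately have "u \<bullet> v x = 0" for x
        using real_polynomial_function_zero_on_open[OF _ X] by blast
      then show False using v \<open>u \<noteq> 0\<close> unfolding poly_basis_def by blast
    qed
  qed
  then show ?thesis using yC by blast
qed

section \<open>Optimality\<close>

text \<open>The value of the problem is finite, as some positive definite moment matrix is feasible, so a
  solution has a positive definite moment matrix. Feasible vectors whose moment matrix is not
  positive definite have determinant \<open>0\<close> and never beat a solution in either formulation.\<close>
lemma optimal_moments_iff_det_maximal:
  assumes v: "poly_basis d v" and w: "poly_basis (2 * d) w"
    and X: "compact X" "interior X \<noteq> {}" and a: "\<forall>x. a \<bullet> w x = 1"
  shows "optimal_moments v w a X y \<longleftrightarrow>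
    y \<in> convex hull (w ` X) \<and> pos_definite (moment_matrix v w y) \<and>
    (\<forall>z\<in>convex hull (w ` X). det (moment_matrix v w z) \<le> det (moment_matrix v w y))"
proof -
  let ?M = "moment_matrix v w" and ?C = "convex hull (w ` X)"
  have feas: "z \<in> moment_cone w X \<and> a \<bullet> z = 1 \<longleftrightarrow> z \<in> ?C" for z
    using probability_moments_eq_convex_hull[OF X(1) poly_basis_continuous[OF w], of a] a by blast
  have pd: "pos_definite (?M z)" if "z \<in> ?C" "det (?M z) > 0" for z
    using pos_definite_if_semidefinite_det_nonzero moment_matrix_semidefinite[OF v w that(1)] that(2)
    by (metis less_irrefl)
  have opt: "optimal_moments v w a X y \<longleftrightarrow>
      y \<in> ?C \<and> (\<forall>z\<in>?C. \<not> neg_log_det (?M z) < neg_log_det (?M y))"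
    by (auto simp: optimal_moments_def is_arg_min_def feas)
  show ?thesis
  proof
    assume "optimal_moments v w a X y"
    then have y: "y \<in> ?C" and min: "\<And>z. z \<in> ?C \<Longrightarrow> \<not> neg_log_det (?M z) < neg_log_det (?M y)"
      by (auto simp: opt)
    obtain y0 where "y0 \<in> ?C" "pos_definite (?M y0)"
      using exists_pos_definite_moment_matrix[OF v w X(2)] by blast
    with min[of y0] have pdy: "pos_definite (?M y)" by (auto simp: neg_log_det_def split: if_splits)
    have "det (?M z) \<le> det (?M y)" if z: "z \<in> ?C" for z
    proof (rule ccontr)
      assume "\<not> ?thesis"
      then have "det (?M y) < det (?M z)" "0 < det (?M y)"
        using pos_definite_det_pos[OF pdy] by auto
      then show False using min[OF z] pd[OF z] pdy by (simp add: neg_log_det_def)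
    qed
    with y pdy show "y \<in> ?C \<and> pos_definite (?M y) \<and> (\<forall>z\<in>?C. det (?M z) \<le> det (?M y))" by blast
  next
    assume y: "y \<in> ?C \<and> pos_definite (?M y) \<and> (\<forall>z\<in>?C. det (?M z) \<le> det (?M y))"
    show "optimal_moments v w a X y"
      unfolding opt
    proof (intro conjI ballI)
      fix z assume "z \<in> ?C"
      then show "\<not> neg_log_det (?M z) < neg_log_det (?M y)"
        using y pos_definite_det_pos[of "?M z"] by (auto simp: neg_log_det_def not_less)
    qed (use y in blast)
  qed
qed

lemma ex_det_maximal_moments:
  assumes v: "poly_basis d v" and w: "poly_basis (2 * d) w" and X: "compact X" "interior X \<noteq> {}"
  shows "\<exists>y\<in>convex hull (w ` X). pos_definite (moment_matrix v w y) \<and>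
    (\<forall>z\<in>convex hull (w ` X). det (moment_matrix v w z) \<le> det (moment_matrix v w y))"
proof -
  let ?M = "moment_matrix v w" and ?C = "convex hull (w ` X)"
  obtain y0 where y0: "y0 \<in> ?C" "pos_definite (?M y0)"
    using exists_pos_definite_moment_matrix[OF v w X(2)] by blast
  have "compact ?C"
    using X(1) poly_basis_continuous[OF w] by (intro compact_convex_hull compact_continuous_image)
  moreover have "continuous_on ?C (\<lambda>y. det (?M y))"
    unfolding det_def
    by (intro continuous_intros linear_continuous_on
        linear_conv_bounded_linear[THEN iffD1] moment_matrix_linear)
  ultimately obtain y where y: "y \<in> ?C" "\<And>z. z \<in> ?C \<Longrightarrow> det (?M z) \<le> det (?M y)"
    using continuous_attains_sup[of ?C "\<lambda>y. det (?M y)"] y0 by blast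
  have "det (?M y) \<noteq> 0" using y(2)[OF y0(1)] pos_definite_det_pos[OF y0(2)] by simp
  then have "pos_definite (?M y)"
    using pos_definite_if_semidefinite_det_nonzero moment_matrix_semidefinite[OF v w y(1)] by metis
  with y show ?thesis by blast
qed

theorem theorem2:
  fixes X :: "(real ^ 'n::finite) set"
    and d :: nat
    and v :: "real ^ 'n \<Rightarrow> real ^ 'm::finite"
    and w :: "real ^ 'n \<Rightarrow> real ^ 'q::finite"
    and a :: "real ^ 'q"
  assumes "d \<ge> 1"
    and "compact X" and "semialgebraic X" and "interior X \<noteq> {}"
    and "CARD('m) = poly_dim CARD('n) d" and "poly_basis d v"
    and "CARD('q) = poly_dim CARD('n) (2 * d)" and "poly_basis (2 * d) w"
    and "\<forall>x. a \<bullet> w x = 1"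
  shows "(\<exists>!y. optimal_moments v w a X y) \<and>
    (\<forall>y. optimal_moments v w a X y \<longrightarrow>
       pos_definite (moment_matrix v w y) \<and>
       y \<in> moment_cone w
             {x \<in> X. christoffel_darboux v w y x = real (poly_dim CARD('n) d)})"
proof -
  note v = assms(6) and w = assms(8)
  let ?M = "moment_matrix v w" and ?C = "convex hull (w ` X)"
  note M_comb = linear_add[OF moment_matrix_linear] linear_scale[OF moment_matrix_linear]
  note opt = optimal_moments_iff_det_maximal[OF v w assms(2,4,9)]
  have unique: "y = z" if "optimal_moments v w a X y" "optimal_moments v w a X z" for y z
  proof (rule ccontr)
    assume "y \<noteq> z"
    then have "?M y \<noteq> ?M z" using moment_matrix_inj[OF v w] by (meson injD)
    have y: "y \<in> ?C" "pos_definite (?M y)" and z: "z \<in> ?C" "pos_definite (?M z)"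
      and eq: "det (?M z) = det (?M y)" and max: "\<And>x. x \<in> ?C \<Longrightarrow> det (?M x) \<le> det (?M y)"
      using that by (auto simp: opt intro: antisym)
    let ?h = "(1/2) *\<^sub>R y + (1/2) *\<^sub>R z"
    have h: "?h \<in> ?C"
      using convexD[OF convex_convex_hull y(1) z(1), of "1/2" "1/2"] by simp
    have "(det (?M y))\<^sup>2 < (det (?M ?h))\<^sup>2"
      using det_midpoint_strict[OF y(2) z(2) \<open>?M y \<noteq> ?M z\<close>] eq by (simp add: M_comb power2_eq_square)
    moreover have "0 \<le> det (?M ?h)"
    proof (rule ccontr)
      assume neg: "\<not> ?thesis"
      then have "pos_definite (?M ?h)"
        using pos_definite_if_semidefinite_det_nonzero moment_matrix_semidefinite[OF v w h]
        by (metis order_refl)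
      then show False using pos_definite_det_pos neg by fastforce
    qed
    ultimately have "det (?M y) < det (?M ?h)" by (simp add: power_less_imp_less_base)
    then show False using max[OF h] by simp
  qed
  have support: "y \<in> moment_cone w
      {x \<in> X. christoffel_darboux v w y x = real (poly_dim CARD('n) d)}"
    if "optimal_moments v w a X y" for y
  proof -
    let ?m = "real (poly_dim CARD('n) d)"
    have y: "y \<in> ?C" "pos_definite (?M y)" and max: "\<And>x. x \<in> ?C \<Longrightarrow> det (?M x) \<le> det (?M y)"
      using that by (auto simp: opt)
    define L where "L z = trace (matrix_inv (?M y) ** ?M z)" for z
    have "linear L"
      unfolding L_def
      by (rule linearI)
        (simp_all add: M_comb trace_def matrix_matrix_mult_def distrib_left sum.distrib
          sum_distrib_left mult_ac)
    have L_point: "L (w x) = christoffel_darboux v w y x" for x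
      by (simp add: L_def moment_matrix_point[OF v w] trace_mult_outer christoffel_darboux_def)
    have "L z \<le> ?m" if z: "z \<in> ?C" for z
    proof -
      have "det ((1 - t) *\<^sub>R ?M y + t *\<^sub>R ?M z) \<le> det (?M y)" if "0 \<le> t" "t \<le> 1" for t
        using max[OF convexD[OF convex_convex_hull y(1) z, of "1 - t" t]] that
        by (simp add: M_comb)
      then show ?thesis
        using trace_inverse_le_if_det_maximal[OF y(2) moment_matrix_semidefinite(1)[OF v w z]]
        by (simp add: L_def assms(5))
    qed
    then have le: "\<And>s. s \<in> w ` X \<Longrightarrow> L s \<le> ?m" by (simp add: hull_inc)
    have "det (?M y) \<noteq> 0" using pos_definite_det_pos[OF y(2)] by simp
    then obtain A' where A': "?M y ** A' = mat 1" "A' ** ?M y = mat 1"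
      by (metis invertible_det_nz invertible_def)
    then have "L y = ?m"
      by (simp add: L_def matrix_inv_eqI[OF A'(1)] trace_def mat_def assms(5))
    from convex_hull_supporting_face[OF \<open>linear L\<close> le y(1) this]
    have "y \<in> convex hull {s \<in> w ` X. L s = ?m}" .
    also have "{s \<in> w ` X. L s = ?m} = w ` {x \<in> X. christoffel_darboux v w y x = ?m}"
      by (auto simp: L_point)
    also have "convex hull \<dots> \<subseteq> moment_cone w {x \<in> X. christoffel_darboux v w y x = ?m}"
      by (intro convex_hull_subset_moment_cone poly_basis_continuous[OF w])
    finally show ?thesis .
  qed
  have "\<exists>y. optimal_moments v w a X y"
    using ex_det_maximal_moments[OF v w assms(2,4)] by (auto simp: opt)
  with unique support show ?thesis by (auto simp: opt)
qed

end
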